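(* Let $r\ge 0$ and $n\ge 1$ be integers and let $G$ be an $r$-regular graph with $n$ vertices. Then there exists a set $R\subseteq V(G)$ with $|R|\ge\left\lceil \frac{n}{r+1}\right\rceil$ such that $G$ has an $R$-sequential $(r+1)$-coloring.
   Context: Graphs are finite, undirected, without loops or multiple edges. A proper edge-coloring of $G$ is a map $\alpha:E(G)\to\mathbb{N}$ with $\alpha(e)\ne\alpha(e')$ for every pair of adjacent edges $e,e'$. A proper $t$-coloring is a proper edge-coloring which makes use of $t$ different colors, namely colors from $\{1,\dots,t\}$. For $R\subseteq V(G)$, a proper $t$-coloring of $G$ is called $R$-sequential if for each vertex $v\in R$ the edges incident to $v$ are colored by exactly the colors $1,2,\dots,d_G(v)$, where $d_G(v)$ is the degree of $v$.
   Formalization: A proper t-coloring is taken to use colors from {1,…,t} without requiring that all t colors occur; if all had to occur, the claim would fail for r = 0 (no edges, one color) and for r = 1, n = 2 (one edge, two colors). *)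

theory Defs
  imports Complex_Main
begin

text \<open>Edges are unordered pairs, represented as two-element sets of vertices, so that
  loops and multiple edges are excluded.\<close>

definition simple_graph :: "'a set \<Rightarrow> 'a set set \<Rightarrow> bool" where
  "simple_graph V E \<longleftrightarrow> finite V \<and> (\<forall>e\<in>E. e \<subseteq> V \<and> card e = 2)"

definition incident_edges :: "'a set set \<Rightarrow> 'a \<Rightarrow> 'a set set" where
  "incident_edges E v = {e \<in> E. v \<in> e}"

definition degree :: "'a set set \<Rightarrow> 'a \<Rightarrow> nat" where
  "degree E v = card (incident_edges E v)"

definition regular_graph :: "nat \<Rightarrow> 'a set \<Rightarrow> 'a set set \<Rightarrow> bool" where
  "regular_graph r V E \<longleftrightarrow> simple_graph V E \<and> (\<forall>v\<in>V. degree E v = r)"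

definition adjacent_edges :: "'a set \<Rightarrow> 'a set \<Rightarrow> bool" where
  "adjacent_edges e e' \<longleftrightarrow> e \<noteq> e' \<and> e \<inter> e' \<noteq> {}"

text \<open>Only the values of a coloring on the edge set \<open>E\<close> are relevant.\<close>

definition proper_edge_coloring :: "'a set set \<Rightarrow> ('a set \<Rightarrow> nat) \<Rightarrow> bool" where
  "proper_edge_coloring E \<alpha> \<longleftrightarrow>
     (\<forall>e\<in>E. \<forall>e'\<in>E. adjacent_edges e e' \<longrightarrow> \<alpha> e \<noteq> \<alpha> e')"

text \<open>The palette of a proper \<open>t\<close>-coloring is \<open>{1..t}\<close>; not every color of the palette has
  to occur on an edge (an edgeless graph has a proper 1-coloring, and a single edge
  a proper 2-coloring).\<close>

definition proper_coloring :: "nat \<Rightarrow> 'a set set \<Rightarrow> ('a set \<Rightarrow> nat) \<Rightarrow> bool" where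
  "proper_coloring t E \<alpha> \<longleftrightarrow> proper_edge_coloring E \<alpha> \<and> \<alpha> ` E \<subseteq> {1..t}"

definition sequential_coloring ::
  "'a set \<Rightarrow> nat \<Rightarrow> 'a set set \<Rightarrow> ('a set \<Rightarrow> nat) \<Rightarrow> bool" where
  "sequential_coloring R t E \<alpha> \<longleftrightarrow>
     proper_coloring t E \<alpha> \<and> (\<forall>v\<in>R. \<alpha> ` incident_edges E v = {1..degree E v})"

end

theory Submission
  imports Defs "HOL-Combinatorics.Transposition"
begin

text \<open>
  By Vizing's theorem an \<open>r\<close>-regular graph has a proper edge coloring with \<open>r + 1\<close> colors, and
  each vertex misses exactly one of them. Some color \<open>c\<close> is missed by at least \<open>n / (r + 1)\<close>
  vertices; exchanging \<open>c\<close> and \<open>r + 1\<close> makes the coloring sequential at all of them.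

  Vizing's theorem is proved by adding one edge \<open>xy\<^sub>0\<close> at a time. Let \<open>m v\<close> be a color missing
  at \<open>v\<close> and let \<open>xy\<^sub>i\<^sub>+\<^sub>1\<close> be the edge of color \<open>m y\<^sub>i\<close>. If some \<open>m y\<^sub>i\<close> is missing at \<open>x\<close>, the
  edges \<open>xy\<^sub>i, \<dots>, xy\<^sub>0\<close> are recolored in this order. Otherwise the sequence returns to itself and
  \<open>m y\<^sub>i = m y\<^sub>j = c\<close> for some \<open>i < j\<close>. With \<open>a = m x\<close>, the \<open>a\<close>-\<open>c\<close>-chain of \<open>x\<close> is a path
  starting at \<open>x\<close>, so it has only one other end and misses one of \<open>y\<^sub>i, y\<^sub>j\<close>; exchanging \<open>a\<close>
  and \<open>c\<close> off this chain makes \<open>a\<close> missing at that vertex as well as at \<open>x\<close>.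
\<close>

section \<open>Missing colors and coloring a single edge\<close>

definition missing :: "'a set set \<Rightarrow> ('a set \<Rightarrow> nat) \<Rightarrow> 'a \<Rightarrow> nat \<Rightarrow> bool" where
  "missing F \<alpha> v c \<longleftrightarrow> c \<notin> \<alpha> ` incident_edges F v"

lemma missing_iff: "missing F \<alpha> v c \<longleftrightarrow> (\<forall>e\<in>F. v \<in> e \<longrightarrow> \<alpha> e \<noteq> c)"
  by (auto simp: missing_def incident_edges_def)

lemma proper_edge_coloring_iff_inj_on:
  "proper_edge_coloring F \<alpha> \<longleftrightarrow> (\<forall>v. inj_on \<alpha> (incident_edges F v))"
  unfolding proper_edge_coloring_def adjacent_edges_def inj_on_def incident_edges_def by blast

lemma proper_edge_coloringD:
  assumes "proper_edge_coloring F \<alpha>" "e \<in> F" "e' \<in> F" "v \<in> e" "v \<in> e'" "\<alpha> e = \<alpha> e'"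
  shows "e = e'"
  using assms unfolding proper_edge_coloring_def adjacent_edges_def by blast

text \<open>The edge \<open>{u, v}\<close> may be new or may already lie in \<open>F\<close>, so
  this serves both to extend a coloring and to recolor within it.\<close>

lemma proper_coloring_update:
  assumes "proper_coloring k F \<alpha>" "missing F \<alpha> u c" "missing F \<alpha> v c" "c \<in> {1..k}"
  shows "proper_coloring k (insert {u, v} F) (\<alpha>({u, v} := c))"
  using assms
  unfolding proper_coloring_def proper_edge_coloring_def adjacent_edges_def missing_iff
  by (auto simp: image_subset_iff)

section \<open>Recoloring along a fan\<close>

text \<open>Giving \<open>a\<close> to the last edge frees its old color at \<open>x\<close>. That
  color is also missing at the preceding vertex of the fan, so it takes the role of \<open>a\<close>
  for a fan with one edge less.\<close>

lemma fan_completion: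
  assumes "proper_coloring k F \<alpha>"
    and "\<And>i. i < j \<Longrightarrow> {x, y (Suc i)} \<in> F"
    and "\<And>i. i < j \<Longrightarrow> missing F \<alpha> (y i) (\<alpha> {x, y (Suc i)})"
    and "inj_on y {..j}" "\<And>i. i \<le> j \<Longrightarrow> y i \<noteq> x"
    and "missing F \<alpha> x a" "missing F \<alpha> (y j) a" "a \<in> {1..k}"
  shows "\<exists>\<beta>. proper_coloring k (insert {x, y 0} F) \<beta>"
  using assms
proof (induction j arbitrary: \<alpha> a)
  case 0
  then show ?case using proper_coloring_update[of k F \<alpha> x a "y 0"] by auto
next
  case (Suc j)
  let ?e = "{x, y (Suc j)}"
  let ?\<beta> = "\<alpha>(?e := a)"
  have eF: "?e \<in> F" using Suc.prems(2) by blast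
  have proper: "proper_edge_coloring F \<alpha>"
    using Suc.prems(1) by (simp add: proper_coloring_def)
  have neq: "y i \<noteq> y (Suc j)" if "i \<le> j" for i
    using inj_onD[OF Suc.prems(4), of i "Suc j"] that by auto
  have edge_neq: "{x, y (Suc i)} \<noteq> ?e" if "i < j" for i
    using neq[of "Suc i"] that by (auto simp: doubleton_eq_iff)
  have keep: "missing F ?\<beta> (y i) d \<longleftrightarrow> missing F \<alpha> (y i) d" if "i \<le> j" for i d
    using neq[OF that] Suc.prems(5)[of i] that by (auto simp: missing_iff)
  show ?case
  proof (rule Suc.IH[where \<alpha> = ?\<beta> and a = "\<alpha> ?e"])
    show "proper_coloring k F ?\<beta>"
      using proper_coloring_update[OF Suc.prems(1,6,7,8)] eF by (simp add: insert_absorb)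
    show "missing F ?\<beta> x (\<alpha> ?e)"
      using Suc.prems(6) eF proper_edge_coloringD[OF proper _ eF, of _ x]
      by (auto simp: missing_iff)
    show "missing F ?\<beta> (y j) (\<alpha> ?e)"
      using keep Suc.prems(3) by blast
    show "\<alpha> ?e \<in> {1..k}"
      using Suc.prems(1) eF by (auto simp: proper_coloring_def)
    show "missing F ?\<beta> (y i) (?\<beta> {x, y (Suc i)})" if "i < j" for i
      using keep[of i] Suc.prems(3)[of i] edge_neq[OF that] that by simp
    show "inj_on y {..j}"
      using Suc.prems(4) by (rule inj_on_subset) auto
  qed (use Suc.prems(2,5) in auto)
qed

section \<open>Kempe chains and color exchange\<close>

text \<open>The orbit of \<open>x\<close> under two involutions is the Kempe chain of \<open>x\<close> when \<open>f\<close> and \<open>g\<close> move each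
  vertex along its edge of the respective color.\<close>

lemma involutions_orbit:
  fixes f g :: "'a \<Rightarrow> 'a"
  assumes f: "\<And>v. f (f v) = v" and g: "\<And>v. g (g v) = v" and x: "f x = x"
  obtains S where "x \<in> S" "\<And>v. v \<in> S \<Longrightarrow> f v \<in> S" "\<And>v. v \<in> S \<Longrightarrow> g v \<in> S"
    "\<And>y z. y \<in> S \<Longrightarrow> z \<in> S \<Longrightarrow> g y = y \<Longrightarrow> g z = z \<Longrightarrow> y = z"
proof -
  \<comment> \<open>The walk alternates the two involutions and starts with \<open>g\<close>, since
    \<open>f\<close> fixes \<open>x\<close>.\<close>
  define w where "w = rec_nat x (\<lambda>i v. if even i then g v else f v)"
  have w0: "w 0 = x" and wS: "w (Suc i) = (if even i then g (w i) else f (w i))" for i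
    by (simp_all add: w_def)
  have fw: "f (w i) = (if i = 0 then x else if even i then w (i - 1) else w (Suc i))" for i
    using x w0 f by (cases i) (auto simp: wS)
  have gw: "g (w i) = (if even i then w (Suc i) else w (i - 1))" for i
    using g by (cases i) (auto simp: wS)
  \<comment> \<open>A fixed point of \<open>g\<close> at an odd index arose by \<open>g\<close> from
    its predecessor, hence equals it.\<close>
  have even_index: "\<exists>m'\<le>m. even m' \<and> w m' = w m" if "g (w m) = w m" for m
    using gw[of m] that by (cases "even m") (auto intro: exI[of _ "m - 1"])
  \<comment> \<open>At a fixed point of \<open>g\<close> with even index the walk turns back and
    runs through its earlier vertices.\<close>
  have initial: "\<exists>i\<le>m. w n = w i" if "even m" "g (w m) = w m" for m n
  proof (induction n)
    case (Suc n)
    then obtain i where i: "i \<le> m" "w n = w i" by blast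
    have step: "f (w i) \<in> w ` {..m}" "g (w i) \<in> w ` {..m}"
      using i that fw[of i] gw[of i] w0
      by (cases "i = m"; force simp: image_iff split: if_splits)+
    then show ?case using i by (auto simp: wS)
  qed auto
  have uniq: "w m = w n" if fixed: "g (w m) = w m" "g (w n) = w n" for m n
  proof -
    \<comment> \<open>Each of two fixed points of \<open>g\<close> occurs no later than the first
      even occurrence of the other, so these first indices agree.\<close>
    define M where "M = (\<lambda>v. LEAST i. even i \<and> w i = v)"
    have M: "even (M (w i)) \<and> w (M (w i)) = w i" if "g (w i) = w i" for i
      unfolding M_def by (rule LeastI_ex) (use even_index[OF that] in blast)
    have M_le: "M (w p) \<le> M (w q)" if pq: "g (w p) = w p" "g (w q) = w q" for p q
    proof -
      obtain i where i: "i \<le> M (w q)" "w p = w i"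
        using initial[of "M (w q)" p] M[OF pq(2)] pq(2) by auto
      then obtain i' where "i' \<le> i" "even i'" "w i' = w i"
        using even_index[of i] pq(1) by auto
      then have "M (w p) \<le> i'" unfolding M_def by (intro Least_le) (simp add: i)
      then show ?thesis using \<open>i' \<le> i\<close> i by linarith
    qed
    have "M (w m) = M (w n)" using M_le fixed by (simp add: order_antisym)
    then show ?thesis using M fixed by metis
  qed
  show thesis
  proof
    show "x \<in> range w" using w0 by (metis rangeI)
    show "f v \<in> range w" if "v \<in> range w" for v
      using that fw w0 by (auto split: if_splits intro: range_eqI[of _ _ 0])
    show "g v \<in> range w" if "v \<in> range w" for v
      using that gw by auto
    show "y = z" if "y \<in> range w" "z \<in> range w" "g y = y" "g z = z" for y z
      using that uniq by blast
  qed
qed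

text \<open>In a proper coloring the edges of color \<open>c\<close> form a matching, so moving
  along them is an involution. Vertices missing \<open>c\<close> become fixed points; this is how
  ends of chains are recognized.\<close>

lemma color_class_involution:
  assumes "\<And>e. e \<in> F \<Longrightarrow> card e = 2" and proper: "proper_edge_coloring F \<alpha>"
  obtains f where "\<And>v. f (f v) = v" "\<And>v. missing F \<alpha> v c \<Longrightarrow> f v = v"
    "\<And>u v. {u, v} \<in> F \<Longrightarrow> \<alpha> {u, v} = c \<Longrightarrow> f u = v"
proof -
  define f where "f v = (if missing F \<alpha> v c then v else SOME w. {v, w} \<in> F \<and> \<alpha> {v, w} = c)" for v
  have edge: "{v, f v} \<in> F \<and> \<alpha> {v, f v} = c" if "\<not> missing F \<alpha> v c" for v
  proof -
    from that obtain e where e: "e \<in> F" "v \<in> e" "\<alpha> e = c"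
      by (auto simp: missing_iff)
    obtain p q where "e = {p, q}" using assms(1)[OF e(1)] by (auto simp: card_2_iff)
    then have "\<exists>w. e = {v, w}" using e(2) by auto
    then have "\<exists>w. {v, w} \<in> F \<and> \<alpha> {v, w} = c" using e by blast
    from someI_ex[OF this] show ?thesis using that by (simp add: f_def)
  qed
  have f_eq: "f u = v" if "{u, v} \<in> F" "\<alpha> {u, v} = c" for u v
  proof -
    have "\<not> missing F \<alpha> u c" using that by (auto simp: missing_iff)
    then have "{u, f u} = {u, v}"
      using proper_edge_coloringD[OF proper, of "{u, f u}" "{u, v}" u] edge[of u] that by simp
    then show ?thesis by (auto simp: doubleton_eq_iff)
  qed
  show thesis
  proof
    show "f (f v) = v" for v
    proof (cases "missing F \<alpha> v c")
      case False
      then show ?thesis using edge[OF False] f_eq[of "f v" v] by (simp add: insert_commute)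
    qed (simp add: f_def)
    show "f v = v" if "missing F \<alpha> v c" for v using that by (simp add: f_def)
  qed (rule f_eq)
qed

text \<open>The colors are exchanged outside \<open>S\<close>, so all edges at \<open>x\<close> keep
  theirs. Both \<open>y\<close> and \<open>z\<close> are fixed by the involution of color
  \<open>c\<close>, and \<open>S\<close> contains at most one such vertex.\<close>

lemma kempe_exchange:
  assumes card2: "\<And>e. e \<in> F \<Longrightarrow> card e = 2" and col: "proper_coloring k F \<alpha>"
    and ac: "a \<in> {1..k}" "c \<in> {1..k}"
    and x: "missing F \<alpha> x a" and yz: "missing F \<alpha> y c" "missing F \<alpha> z c" "y \<noteq> z"
  obtains \<beta> S where "proper_coloring k F \<beta>" "x \<in> S" "y \<notin> S \<or> z \<notin> S"
    "\<And>e v. e \<in> F \<Longrightarrow> v \<in> e \<Longrightarrow> v \<in> S \<Longrightarrow> \<beta> e = \<alpha> e"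
    "\<And>e v. e \<in> F \<Longrightarrow> v \<in> e \<Longrightarrow> v \<notin> S \<Longrightarrow> \<beta> e = transpose a c (\<alpha> e)"
proof -
  have proper: "proper_edge_coloring F \<alpha>" using col by (simp add: proper_coloring_def)
  obtain f where f: "\<And>v. f (f v) = v" "\<And>v. missing F \<alpha> v a \<Longrightarrow> f v = v"
      "\<And>u v. {u, v} \<in> F \<Longrightarrow> \<alpha> {u, v} = a \<Longrightarrow> f u = v"
    using color_class_involution[OF card2 proper] by metis
  obtain g where g: "\<And>v. g (g v) = v" "\<And>v. missing F \<alpha> v c \<Longrightarrow> g v = v"
      "\<And>u v. {u, v} \<in> F \<Longrightarrow> \<alpha> {u, v} = c \<Longrightarrow> g u = v"
    using color_class_involution[OF card2 proper] by metis
  obtain S where S: "x \<in> S" "\<And>v. v \<in> S \<Longrightarrow> f v \<in> S" "\<And>v. v \<in> S \<Longrightarrow> g v \<in> S"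
    "\<And>y z. y \<in> S \<Longrightarrow> z \<in> S \<Longrightarrow> g y = y \<Longrightarrow> g z = z \<Longrightarrow> y = z"
    using involutions_orbit[of f g x, OF f(1) g(1) f(2)[OF x]] by metis
  have closed: "v \<in> S" if "e \<in> F" "\<alpha> e = a \<or> \<alpha> e = c" "u \<in> e" "u \<in> S" "v \<in> e" for e u v
  proof (cases "u = v")
    case False
    then have "e = {u, v}" using card2[OF \<open>e \<in> F\<close>] that by (auto simp: card_2_iff)
    then show ?thesis using f(3)[of u v] g(3)[of u v] S(2,3)[OF \<open>u \<in> S\<close>] that by auto
  qed (use that in simp)
  define \<beta> where "\<beta> e = (if e \<inter> S = {} then transpose a c (\<alpha> e) else \<alpha> e)" for e
  have on: "\<beta> e = \<alpha> e" if "v \<in> e" "v \<in> S" for e v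
    using that by (auto simp: \<beta>_def)
  \<comment> \<open>An edge between \<open>S\<close> and its complement has neither color by
    \<open>closed\<close>, so the exchange would not affect it.\<close>
  have off: "\<beta> e = transpose a c (\<alpha> e)" if "e \<in> F" "v \<in> e" "v \<notin> S" for e v
  proof (cases "e \<inter> S = {}")
    case False
    then have "\<alpha> e \<noteq> a" "\<alpha> e \<noteq> c" using closed that by blast+
    then show ?thesis using False by (simp add: \<beta>_def transpose_def)
  qed (simp add: \<beta>_def)
  show thesis
  proof
    show "proper_coloring k F \<beta>" unfolding proper_coloring_def
    proof
      show "proper_edge_coloring F \<beta>"
        unfolding proper_edge_coloring_def adjacent_edges_def
      proof (intro ballI impI notI)
        fix e e' assume e: "e \<in> F" "e' \<in> F" "e \<noteq> e' \<and> e \<inter> e' \<noteq> {}" "\<beta> e = \<beta> e'"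
        then obtain v where v: "v \<in> e" "v \<in> e'" by blast
        have "\<alpha> e = \<alpha> e'"
          using e v on off by (cases "v \<in> S") (auto dest: transpose_eq_imp_eq)
        then show False using proper_edge_coloringD[OF proper] e v by blast
      qed
      show "\<beta> ` F \<subseteq> {1..k}"
        using col ac by (auto simp: \<beta>_def proper_coloring_def transpose_def)
    qed
    show "y \<notin> S \<or> z \<notin> S" using S(4) g(2) yz by blast
  qed (use S(1) on off in blast)+
qed

section \<open>Vizing's theorem\<close>

lemma ex_missing:
  assumes "finite F" "degree F v < k"
  shows "\<exists>c\<in>{1..k}. missing F \<alpha> v c"
proof (rule ccontr)
  assume "\<not> ?thesis"
  then have "{1..k} \<subseteq> \<alpha> ` incident_edges F v" by (auto simp: missing_def)
  moreover have "finite (incident_edges F v)" using assms(1) by (simp add: incident_edges_def)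
  ultimately have "k \<le> card (incident_edges F v)"
    using surj_card_le[of "incident_edges F v" "{1..k}" \<alpha>] by simp
  then show False using assms(2) by (simp add: degree_def)
qed

lemma proper_coloring_insert:
  assumes "finite F" and card2: "\<And>e. e \<in> F \<Longrightarrow> card e = 2" and deg: "\<And>v. degree F v < k"
    and col: "proper_coloring k F \<alpha>" and "x \<noteq> y0" "{x, y0} \<notin> F"
  shows "\<exists>\<beta>. proper_coloring k (insert {x, y0} F) \<beta>"
proof -
  have proper: "proper_edge_coloring F \<alpha>" using col by (simp add: proper_coloring_def)
  obtain m where m: "\<And>v. m v \<in> {1..k}" "\<And>v. missing F \<alpha> v (m v)"
    using ex_missing[OF \<open>finite F\<close> deg] by metis
  \<comment> \<open>This is the next vertex of the fan; its value is arbitrary if \<open>m z\<close>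
    is missing at \<open>x\<close>.\<close>
  define h where "h z = (SOME w. {x, w} \<in> F \<and> \<alpha> {x, w} = m z)" for z
  have h: "{x, h z} \<in> F \<and> \<alpha> {x, h z} = m z" if "\<not> missing F \<alpha> x (m z)" for z
  proof -
    from that obtain e where e: "e \<in> F" "x \<in> e" "\<alpha> e = m z" by (auto simp: missing_iff)
    then have "\<exists>w. e = {x, w}" using card2[of e] by (auto simp: card_2_iff)
    then have "\<exists>w. {x, w} \<in> F \<and> \<alpha> {x, w} = m z" using e by blast
    from someI_ex[OF this] show ?thesis by (simp add: h_def)
  qed
  define y where "y i = (h ^^ i) y0" for i
  have y0: "y 0 = y0" and yS: "y (Suc i) = h (y i)" for i by (simp_all add: y_def)
  have nx: "w \<noteq> x" if "{x, w} \<in> F" for w using card2[OF that] by auto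
  show ?thesis
  proof (cases "\<exists>i. missing F \<alpha> x (m (y i))")
    case True
    define j where "j = (LEAST i. missing F \<alpha> x (m (y i)))"
    have j: "missing F \<alpha> x (m (y j))" unfolding j_def using True by (rule LeastI_ex)
    have less: "\<not> missing F \<alpha> x (m (y i))" if "i < j" for i
      using that not_less_Least unfolding j_def by blast
    have edge: "{x, y (Suc i)} \<in> F" "\<alpha> {x, y (Suc i)} = m (y i)" if "i < j" for i
      using h[OF less[OF that]] by (simp_all add: yS)
    \<comment> \<open>Iterating \<open>h\<close> from a repetition leads to \<open>y j\<close> at an
      index below \<open>j\<close>, against the minimality of \<open>j\<close>.\<close>
    have no_repeat: "y p \<noteq> y q" if "p < q" "q \<le> j" for p q
    proof
      assume "y p = y q"
      then have "y (j - q + p) = y (j - q + q)" by (simp add: y_def funpow_add)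
      moreover have "j - q + p < j" "j - q + q = j" using that by auto
      ultimately show False using less j by metis
    qed
    have "\<exists>\<beta>. proper_coloring k (insert {x, y 0} F) \<beta>"
    proof (rule fan_completion[OF col])
      show "inj_on y {..j}" by (rule linorder_inj_onI) (use no_repeat in auto)
      show "y i \<noteq> x" if "i \<le> j" for i
        using that nx[OF edge(1)] y0 \<open>x \<noteq> y0\<close> by (cases i) auto
    qed (use j m edge in auto)
    then show ?thesis by (simp add: y0)
  next
    case False
    then have edge: "{x, y (Suc i)} \<in> F" "\<alpha> {x, y (Suc i)} = m (y i)" for i
      using h[of "y i"] by (auto simp: yS)
    have nxi: "y i \<noteq> x" for i
      using nx[OF edge(1)] y0 \<open>x \<noteq> y0\<close> by (cases i) auto
    have "y i \<in> insert y0 (\<Union>F)" for i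
    proof (cases i)
      case (Suc l)
      then show ?thesis using edge(1)[of l] by blast
    qed (simp add: y0)
    then have "range y \<subseteq> insert y0 (\<Union>F)" by blast
    moreover have "finite (\<Union>F)"
      using \<open>finite F\<close> card2 by (intro finite_Union) (auto intro: card_ge_0_finite)
    ultimately have "finite (range y)" by (meson finite.insertI finite_subset)
    then have "\<not> inj y" using finite_imageD by blast
    then obtain p q where "p < q" "y p = y q"
      by (metis injI linorder_neqE_nat)
    then have ex: "\<exists>q. \<exists>p<q. y p = y q" by blast
    define q where "q = (LEAST q. \<exists>p<q. y p = y q)"
    obtain p where p: "p < q" "y p = y q" using LeastI_ex[OF ex] unfolding q_def by blast
    have no_repeat: "y s \<noteq> y t" if "s < t" "t < q" for s t
      using that not_less_Least[of t "\<lambda>q. \<exists>p<q. y p = y q"] unfolding q_def by blast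
    obtain j where j: "q = Suc j" using p by (cases q) auto
    \<comment> \<open>The sequence cannot return to \<open>y 0\<close>: \<open>y q\<close> is joined
      to \<open>x\<close> by an edge of \<open>F\<close>, \<open>y0\<close> is not.\<close>
    have "p \<noteq> 0"
      using p(2) edge(1)[of j] \<open>{x, y0} \<notin> F\<close> unfolding j y0[symmetric] by metis
    then obtain i where i: "p = Suc i" by (cases p) auto
    have ij: "i < j" using p i j by simp
    have inj: "inj_on y {..j}"
      by (rule linorder_inj_onI) (use no_repeat j in auto)
    define a where "a = m x"
    define c where "c = m (y j)"
    \<comment> \<open>Both are the color of the same edge, as
      \<open>y (Suc i) = y (Suc j)\<close>.\<close>
    have ci: "m (y i) = c"
      using edge(2)[of i] edge(2)[of j] p i j by (simp add: c_def)
    have ac: "a \<in> {1..k}" "c \<in> {1..k}" using m(1) unfolding a_def c_def by blast+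
    have mis: "missing F \<alpha> x a" "missing F \<alpha> (y i) c" "missing F \<alpha> (y j) c"
      using m(2)[of x] m(2)[of "y i"] m(2)[of "y j"] ci by (simp_all add: a_def c_def)
    have "y i \<noteq> y j" using no_repeat[OF ij] j by simp
    from kempe_exchange[OF card2 col ac mis this] obtain \<beta> S where \<beta>: "proper_coloring k F \<beta>" and S: "x \<in> S" "y i \<notin> S \<or> y j \<notin> S"
      and on: "\<And>e v. e \<in> F \<Longrightarrow> v \<in> e \<Longrightarrow> v \<in> S \<Longrightarrow> \<beta> e = \<alpha> e"
      and off: "\<And>e v. e \<in> F \<Longrightarrow> v \<in> e \<Longrightarrow> v \<notin> S \<Longrightarrow> \<beta> e = transpose a c (\<alpha> e)"
      by blast
    have missing_on: "missing F \<beta> v d \<longleftrightarrow> missing F \<alpha> v d" if "v \<in> S" for v d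
      using on that by (auto simp: missing_iff)
    have missing_off: "missing F \<beta> v d \<longleftrightarrow> missing F \<alpha> v (transpose a c d)" if "v \<notin> S" for v d
      using off that by (auto simp: missing_iff transpose_eq_iff)
    have \<beta>x: "\<beta> {x, y (Suc l)} = m (y l)" for l
      using on[OF edge(1), of x] S(1) edge(2) by simp
    \<comment> \<open>The color \<open>a\<close> is missing at \<open>x\<close> and only one edge at
      \<open>x\<close> has color \<open>c\<close>. So for \<open>l < j\<close> other than
      \<open>i\<close> the exchange does not touch \<open>m (y l)\<close>.\<close>
    have ma: "m (y l) \<noteq> a" for l using False m(2)[of x] unfolding a_def by metis
    have mc: "m (y l) \<noteq> c" if "l < j" "l \<noteq> i" for l
    proof
      assume "m (y l) = c"
      then have "{x, y (Suc l)} = {x, y (Suc i)}"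
        using proper_edge_coloringD[OF proper edge(1)[of l] edge(1)[of i], of x] ci
        by (simp add: edge(2))
      then have "y (Suc l) = y (Suc i)" by (auto simp: doubleton_eq_iff)
      then show False using inj_onD[OF inj, of "Suc l" "Suc i"] that ij by simp
    qed
    have fan: "missing F \<beta> (y l) (m (y l))" if "l < j" "l \<noteq> i" for l
      using missing_on missing_off ma mc[OF that] m(2) by (cases "y l \<in> S") auto
    have ax: "missing F \<beta> x a" using missing_on S(1) m(2) by (simp add: a_def)
    have "\<exists>\<beta>. proper_coloring k (insert {x, y 0} F) \<beta>"
    proof (cases "y i \<in> S")
      case False
      \<comment> \<open>The exchange makes \<open>a\<close> missing at \<open>y i\<close>; the fan
        is cut there, before the exceptional index is used.\<close>
      show ?thesis
      proof (rule fan_completion[OF \<beta>])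
        show "missing F \<beta> (y i) a" using missing_off[OF False] m(2)[of "y i"] ci by simp
        show "missing F \<beta> (y l) (\<beta> {x, y (Suc l)})" if "l < i" for l
          using fan[of l] that ij by (simp add: \<beta>x)
        show "inj_on y {..i}" using inj ij by (auto intro: inj_on_subset)
        show "a \<in> {1..k}" unfolding a_def by (rule m)
      qed (use edge(1) nxi ax in auto)
    next
      case True
      \<comment> \<open>Now \<open>c\<close> stays missing at \<open>y i\<close>, so the whole fan
        survives, and \<open>a\<close> becomes missing at its end \<open>y j\<close>.\<close>
      show ?thesis
      proof (rule fan_completion[OF \<beta>])
        show "missing F \<beta> (y j) a"
          using missing_off[of "y j"] S(2) True m(2)[of "y j"] by (simp add: c_def)
        show "missing F \<beta> (y l) (\<beta> {x, y (Suc l)})" if "l < j" for l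
          using fan[of l] that missing_on[OF True] m(2)[of "y i"] by (cases "l = i") (auto simp: \<beta>x)
        show "a \<in> {1..k}" unfolding a_def by (rule m)
      qed (use inj edge(1) nxi ax in auto)
    qed
    then show ?thesis by (simp add: y0)
  qed
qed

theorem vizing:
  assumes "finite E" "\<And>e. e \<in> E \<Longrightarrow> card e = 2" "\<And>v. degree E v < k"
  shows "\<exists>\<alpha>. proper_coloring k E \<alpha>"
  using assms
proof (induction E)
  case empty
  then show ?case by (simp add: proper_coloring_def proper_edge_coloring_def)
next
  case (insert e F)
  have "degree F v \<le> degree (insert e F) v" for v
    unfolding degree_def incident_edges_def using insert.hyps(1) by (auto intro: card_mono)
  then have deg: "degree F v < k" for v using insert.prems(2) le_less_trans by blast
  then obtain \<alpha> where \<alpha>: "proper_coloring k F \<alpha>"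
    using insert.IH insert.prems(1) by blast
  obtain x y0 where e: "e = {x, y0}" "x \<noteq> y0"
    using insert.prems(1)[of e] by (auto simp: card_2_iff)
  have "card e' = 2" if "e' \<in> F" for e' using insert.prems(1) that by blast
  from proper_coloring_insert[OF insert.hyps(1) this deg \<alpha> e(2)] show ?case
    using insert.hyps(2) e(1) by simp
qed

section \<open>From a proper to a sequential coloring\<close>

text \<open>Averaging: the fibers partition \<open>V\<close>, so they cannot all be smaller than the
  mean.\<close>

lemma ex_large_fiber:
  assumes "finite V" "finite C" "f ` V \<subseteq> C" "C \<noteq> {}"
  shows "\<exists>c\<in>C. card V \<le> card C * card {v \<in> V. f v = c}"
proof (rule ccontr)
  assume "\<not> ?thesis"
  then have less: "card C * card {v \<in> V. f v = c} < card V" if "c \<in> C" for c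
    using that by force
  have "card V = (\<Sum>c\<in>C. card {v \<in> V. f v = c})"
    using sum.group[OF assms(1,2,3), of "\<lambda>_. 1::nat"] by simp
  then have "card C * card V = (\<Sum>c\<in>C. card C * card {v \<in> V. f v = c})"
    by (simp add: sum_distrib_left)
  also have "\<dots> < (\<Sum>c\<in>C. card V)"
    using assms(2,4) less by (intro sum_strict_mono) auto
  finally show False by simp
qed

theorem theorem5:
  fixes V :: "'a set" and E :: "'a set set" and r n :: nat
  assumes "n \<ge> 1"
    and "regular_graph r V E"
    and "card V = n"
  shows "\<exists>R \<subseteq> V. int (card R) \<ge> \<lceil>real n / real (r + 1)\<rceil> \<and>
           (\<exists>\<alpha>. sequential_coloring R (r + 1) E \<alpha>)"
proof -
  have "finite V" and EV: "\<And>e. e \<in> E \<Longrightarrow> e \<subseteq> V" and card2: "\<And>e. e \<in> E \<Longrightarrow> card e = 2"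
    and deg: "\<And>v. v \<in> V \<Longrightarrow> degree E v = r"
    using assms(2) by (auto simp: regular_graph_def simple_graph_def)
  have "E \<subseteq> Pow V" using EV by blast
  then have "finite E" using \<open>finite V\<close> by (meson finite_Pow_iff finite_subset)
  \<comment> \<open>\<open>vizing\<close> asks for the bound at every \<open>v\<close> of the type;
    outside \<open>V\<close> the degree is 0.\<close>
  have "degree E v < r + 1" for v
  proof (cases "v \<in> V")
    case False
    then have "incident_edges E v = {}" using EV by (auto simp: incident_edges_def)
    then show ?thesis by (simp add: degree_def)
  qed (simp add: deg)
  note deg_less = this
  obtain \<alpha> where \<alpha>: "proper_coloring (r + 1) E \<alpha>"
    using vizing[OF \<open>finite E\<close> card2 deg_less] by blast
  obtain m where m: "\<And>v. m v \<in> {1..r + 1}" "\<And>v. missing E \<alpha> v (m v)"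
    using ex_missing[OF \<open>finite E\<close> deg_less] by metis
  \<comment> \<open>The \<open>r\<close> edges at \<open>v\<close> have distinct colors among the
    \<open>r\<close> colors other than \<open>m v\<close>, so all of these occur.\<close>
  have colors: "\<alpha> ` incident_edges E v = {1..r + 1} - {m v}" if "v \<in> V" for v
  proof (rule card_subset_eq)
    show "\<alpha> ` incident_edges E v \<subseteq> {1..r + 1} - {m v}"
      using m(2)[of v] \<alpha> by (auto simp: missing_iff proper_coloring_def incident_edges_def)
    have "inj_on \<alpha> (incident_edges E v)"
      using \<alpha> by (simp add: proper_coloring_def proper_edge_coloring_iff_inj_on)
    then show "card (\<alpha> ` incident_edges E v) = card ({1..r + 1} - {m v})"
      using deg[OF that] m(1)[of v] by (simp add: card_image degree_def)
  qed simp
  have "m ` V \<subseteq> {1..r + 1}" using m(1) by blast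
  then obtain c where c: "c \<in> {1..r + 1}" "card V \<le> (r + 1) * card {v \<in> V. m v = c}"
    using ex_large_fiber[OF \<open>finite V\<close>, of "{1..r + 1}" m] by auto
  define R where "R = {v \<in> V. m v = c}"
  \<comment> \<open>On \<open>R\<close> the missing color \<open>c\<close> becomes
    \<open>r + 1\<close>, which leaves exactly \<open>1\<close> to \<open>r\<close>.\<close>
  define \<beta> where "\<beta> = transpose c (r + 1) \<circ> \<alpha>"
  have "real n \<le> real (r + 1) * real (card R)"
    using c(2) assms(3) unfolding R_def by (metis of_nat_le_iff of_nat_mult)
  then have "real n / real (r + 1) \<le> real (card R)"
    by (simp add: divide_le_eq mult.commute)
  then have "\<lceil>real n / real (r + 1)\<rceil> \<le> int (card R)"
    by (simp add: ceiling_le_iff)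
  moreover have "sequential_coloring R (r + 1) E \<beta>"
    unfolding sequential_coloring_def
  proof
    have perm: "transpose c (r + 1) ` {1..r + 1} = {1..r + 1}"
      using c(1) by (simp add: transpose_image_eq)
    have "inj_on \<beta> (incident_edges E v)" for v
      unfolding \<beta>_def using \<alpha>
      by (intro comp_inj_on inj_on_subset[OF inj_transpose])
        (auto simp: proper_coloring_def proper_edge_coloring_iff_inj_on)
    moreover have "\<beta> ` E \<subseteq> {1..r + 1}"
      using \<alpha> image_mono[of "\<alpha> ` E" "{1..r + 1}" "transpose c (r + 1)"] perm
      by (simp add: \<beta>_def proper_coloring_def image_comp)
    ultimately show "proper_coloring (r + 1) E \<beta>"
      by (simp add: proper_coloring_def proper_edge_coloring_iff_inj_on)
    show "\<forall>v\<in>R. \<beta> ` incident_edges E v = {1..degree E v}"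
    proof
      fix v assume "v \<in> R"
      then have v: "v \<in> V" "m v = c" by (auto simp: R_def)
      have "\<beta> ` incident_edges E v = transpose c (r + 1) ` ({1..r + 1} - {c})"
        unfolding \<beta>_def image_comp[symmetric] colors[OF v(1)] v(2) ..
      also have "\<dots> = {1..r + 1} - {r + 1}"
        using perm by (simp add: image_set_diff[OF inj_transpose])
      also have "\<dots> = {1..degree E v}" using deg[OF v(1)] by auto
      finally show "\<beta> ` incident_edges E v = {1..degree E v}" .
    qed
  qed
  moreover have "R \<subseteq> V" by (auto simp: R_def)
  ultimately show ?thesis by (intro exI[of _ R]) auto
qed

end
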